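(* Let $d\ge2$, let $H_1,\dots,H_d$ be Hilbert spaces (all real or all complex), let $\mathbf{H}=H_1\otimes\cdots\otimes H_d$ be their Hilbert space tensor product, and let $\mathbf{A}$ be a self-adjoint operator on $\mathbf{H}$ such that for some constants $0<\gamma<\Gamma<\infty$ $$\gamma\|\mathbf{v}\|_{\mathbf{H}}^2\le\langle\mathbf{v},\mathbf{A}\mathbf{v}\rangle_{\mathbf{H}}\le\Gamma\|\mathbf{v}\|_{\mathbf{H}}^2\qquad\text{for all }\mathbf{v}\in\mathbf{H}.$$ Let $t\subseteq\{1,\dots,d\}$ with $0<|t|<d$, let $t^c=\{1,\dots,d\}\setminus t$, and suppose that, with respect to the identification $\mathbf{H}\cong\big(\bigotimes_{\mu\in t}H_\mu\big)\otimes\big(\bigotimes_{\nu\in t^c}H_\nu\big)$, $$\mathbf{A}=\sum_{i=1}^{r_{\mathbf{A}}^{(t)}}A_i^{(t)}\otimes A_i^{(t^c)},\qquad \mathbf{b}=\sum_{j=1}^{r_{\mathbf{b}}^{(t)}}b_j^{(t)}\otimes b_j^{(t^c)},$$ where $A_i^{(t)}$ and $A_i^{(t^c)}$ are bounded linear operators on $\bigotimes_{\mu\in t}H_\mu$ and $\bigotimes_{\nu\in t^c}H_\nu$, respectively, $b_j^{(t)}\in\bigotimes_{\mu\in t}H_\mu$, $b_j^{(t^c)}\in\bigotimes_{\nu\in t^c}H_\nu$, and $r_{\mathbf{b}}^{(t)}\le r_{\mathbf{A}}^{(t)}$. Let $\kappa=\Gamma/\gamma$ and $q=\frac{\kappa-1}{\kappa+1}$.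 Then the solution $\mathbf{u}\in\mathbf{H}$ of $\mathbf{A}\mathbf{u}=\mathbf{b}$ satisfies, for every integer $r\ge1$, $$\tau_r^{(t)}(\mathbf{u})\le\frac{\|\mathbf{u}\|_{\mathbf{H}}}{q}\left(\frac1r\right)^{\left|\frac{\ln q}{\ln R^{(t)}}\right|}$$ with $R^{(t)}=r_{\mathbf{A}}^{(t)}+2$. If, additionally, $A_i^{(t)}$ or $A_i^{(t^c)}$ is the identity for some $i$, then the same bound holds with $R^{(t)}=r_{\mathbf{A}}^{(t)}+1$.
   Context: For $\mathbf{v}\in\mathbf{H}$, the $t$-rank $\operatorname{rank}^{(t)}(\mathbf{v})$ is the rank of $\mathbf{v}$ viewed as an element of the two-fold tensor product $\big(\bigotimes_{\mu\in t}H_\mu\big)\otimes\big(\bigotimes_{\nu\notin t}H_\nu\big)$, i.e. the rank of the associated Hilbert–Schmidt operator (the number of its nonzero singular values $\sigma^{(t)}_1\ge\sigma^{(t)}_2\ge\dots\ge0$, possibly $\infty$). The best approximation error of $t$-rank at most $r$ is $$\tau_r^{(t)}(\mathbf{u})=\min_{\operatorname{rank}^{(t)}(\mathbf{v})\le r}\|\mathbf{u}-\mathbf{v}\|_{\mathbf{H}}=\Big(\sum_{k\ge r+1}(\sigma_k^{(t)})^2\Big)^{1/2},$$ where $\sigma_k^{(t)}$ are the singular values of $\mathbf{u}$ with respect to this splitting. *)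

theory Defs
  imports "HOL-Analysis.Analysis" "HOL-Algebra.Module" "HOL-Library.Extended_Nat"
begin

section \<open>Hilbert spaces over the reals or the complex numbers\<close>

text \<open>
  The scalar field is a set \<open>K\<close> of complex numbers, either \<open>\<real>\<close> or \<open>UNIV\<close>, so that the
  real and the complex case share one definition; for \<open>K = \<real>\<close> the inner product is real-valued
  and \<open>cnj\<close> acts as the identity.  Spaces are carrier-based, because a family \<open>H\<^sub>1, \<dots>, H\<^sub>d\<close> of
  variable length needs members of one Isabelle type; the carriers and operations of the members
  are unrelated.  Inner products are linear in the second argument.  The fields \<open>mult\<close> and \<open>one\<close>
  inherited from the module record play no role.
\<close>

definition scalars :: "complex set \<Rightarrow> complex ring" where
  "scalars K = \<lparr>carrier = K, mult = (*), one = 1, zero = 0, add = (+)\<rparr>"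

record 'a hilb = "(complex, 'a) module" +
  ip :: "'a \<Rightarrow> 'a \<Rightarrow> complex"

definition hnorm :: "'a hilb \<Rightarrow> 'a \<Rightarrow> real" where
  "hnorm H x = sqrt (Re (ip H x x))"

definition hdist :: "'a hilb \<Rightarrow> 'a \<Rightarrow> 'a \<Rightarrow> real" where
  "hdist H x y = hnorm H (x \<ominus>\<^bsub>H\<^esub> y)"

locale hilbert_space = Module.module "scalars K" H
  for K :: "complex set" and H :: "'a hilb" (structure) +
  assumes real_or_complex: "K = \<real> \<or> K = UNIV"
    and ip_closed: "x \<in> carrier H \<Longrightarrow> y \<in> carrier H \<Longrightarrow> ip H x y \<in> K"
    and ip_add_right: "x \<in> carrier H \<Longrightarrow> y \<in> carrier H \<Longrightarrow> z \<in> carrier H \<Longrightarrow>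
          ip H x (y \<oplus> z) = ip H x y + ip H x z"
    and ip_smult_right: "c \<in> K \<Longrightarrow> x \<in> carrier H \<Longrightarrow> y \<in> carrier H \<Longrightarrow>
          ip H x (c \<odot> y) = c * ip H x y"
    and ip_commute: "x \<in> carrier H \<Longrightarrow> y \<in> carrier H \<Longrightarrow> ip H y x = cnj (ip H x y)"
    and ip_pos: "x \<in> carrier H \<Longrightarrow> x \<noteq> \<zero> \<Longrightarrow> 0 < Re (ip H x x)"
    and complete: "Metric_space.mcomplete (carrier H) (hdist H)"

definition lin_span :: "complex set \<Rightarrow> 'a hilb \<Rightarrow> 'a set \<Rightarrow> 'a set" where
  "lin_span K H S =
     {\<Oplus>\<^bsub>H\<^esub>x\<in>B. c x \<odot>\<^bsub>H\<^esub> x | B c. finite B \<and> B \<subseteq> S \<and> c \<in> B \<rightarrow> K}"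

definition dense_in :: "'a hilb \<Rightarrow> 'a set \<Rightarrow> bool" where
  "dense_in H S \<longleftrightarrow>
     Metric_space.mtopology (carrier H) (hdist H) closure_of S = carrier H"

definition bounded_op ::
  "complex set \<Rightarrow> 'a hilb \<Rightarrow> ('a \<Rightarrow> 'a) \<Rightarrow> bool" where
  "bounded_op K H A \<longleftrightarrow>
     A \<in> carrier H \<rightarrow> carrier H \<and>
     (\<forall>x\<in>carrier H. \<forall>y\<in>carrier H. A (x \<oplus>\<^bsub>H\<^esub> y) = A x \<oplus>\<^bsub>H\<^esub> A y) \<and>
     (\<forall>c\<in>K. \<forall>x\<in>carrier H. A (c \<odot>\<^bsub>H\<^esub> x) = c \<odot>\<^bsub>H\<^esub> A x) \<and>
     (\<exists>M. \<forall>x\<in>carrier H. hnorm H (A x) \<le> M * hnorm H x)"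

definition self_adjoint_op ::
  "complex set \<Rightarrow> 'a hilb \<Rightarrow> ('a \<Rightarrow> 'a) \<Rightarrow> bool" where
  "self_adjoint_op K H A \<longleftrightarrow>
     bounded_op K H A \<and>
     (\<forall>x\<in>carrier H. \<forall>y\<in>carrier H. ip H (A x) y = ip H x (A y))"


section \<open>Hilbert space tensor products\<close>

text \<open>
  A Hilbert tensor product of \<open>H \<mu>\<close>, \<open>\<mu> \<in> I\<close>, is a Hilbert space \<open>T\<close> with a multilinear map \<open>tens\<close>
  (sending \<open>v\<close> to the elementary tensor of the \<open>v \<mu>\<close>) that induces the product inner product on
  elementary tensors and whose image spans a dense subspace; that is, \<open>T\<close> is the completion of
  the algebraic tensor product.  This determines \<open>(T, tens)\<close> up to a unique unitary map.
  On the given domain \<open>tens v\<close> only depends on the restriction of \<open>v\<close> to \<open>I\<close>, by \<open>ip_tens\<close>.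
\<close>

locale hilbert_tensor =
  T: hilbert_space K T
  for K :: "complex set" and I :: "nat set" and H :: "nat \<Rightarrow> 'a hilb"
    and T :: "'b hilb" and tens :: "(nat \<Rightarrow> 'a) \<Rightarrow> 'b" +
  assumes finite_index: "finite I"
    and factor: "\<mu> \<in> I \<Longrightarrow> hilbert_space K (H \<mu>)"
    and tens_closed: "v \<in> (\<Pi> \<mu>\<in>I. carrier (H \<mu>)) \<Longrightarrow> tens v \<in> carrier T"
    and tens_add: "v \<in> (\<Pi> \<mu>\<in>I. carrier (H \<mu>)) \<Longrightarrow> \<mu> \<in> I \<Longrightarrow>
          x \<in> carrier (H \<mu>) \<Longrightarrow> y \<in> carrier (H \<mu>) \<Longrightarrow>
          tens (v(\<mu> := x \<oplus>\<^bsub>H \<mu>\<^esub> y)) = tens (v(\<mu> := x)) \<oplus>\<^bsub>T\<^esub> tens (v(\<mu> := y))"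
    and tens_smult: "v \<in> (\<Pi> \<mu>\<in>I. carrier (H \<mu>)) \<Longrightarrow> \<mu> \<in> I \<Longrightarrow>
          c \<in> K \<Longrightarrow> x \<in> carrier (H \<mu>) \<Longrightarrow>
          tens (v(\<mu> := c \<odot>\<^bsub>H \<mu>\<^esub> x)) = c \<odot>\<^bsub>T\<^esub> tens (v(\<mu> := x))"
    and ip_tens: "v \<in> (\<Pi> \<mu>\<in>I. carrier (H \<mu>)) \<Longrightarrow> w \<in> (\<Pi> \<mu>\<in>I. carrier (H \<mu>)) \<Longrightarrow>
          ip T (tens v) (tens w) = (\<Prod>\<mu>\<in>I. ip (H \<mu>) (v \<mu>) (w \<mu>))"
    and dense: "dense_in T (lin_span K T (tens ` (\<Pi> \<mu>\<in>I. carrier (H \<mu>))))"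

text \<open>The two-fold case, with factors \<open>X\<close> and \<open>Y\<close> of different types.\<close>

locale hilbert_tensor2 =
  X: hilbert_space K X + Y: hilbert_space K Y + Z: hilbert_space K Z
  for K :: "complex set" and X :: "'b hilb" and Y :: "'c hilb" and Z :: "'d hilb"
    and tp :: "'b \<Rightarrow> 'c \<Rightarrow> 'd" +
  assumes tp_closed: "x \<in> carrier X \<Longrightarrow> y \<in> carrier Y \<Longrightarrow> tp x y \<in> carrier Z"
    and tp_add_left: "x \<in> carrier X \<Longrightarrow> x' \<in> carrier X \<Longrightarrow> y \<in> carrier Y \<Longrightarrow>
          tp (x \<oplus>\<^bsub>X\<^esub> x') y = tp x y \<oplus>\<^bsub>Z\<^esub> tp x' y"
    and tp_add_right: "x \<in> carrier X \<Longrightarrow> y \<in> carrier Y \<Longrightarrow> y' \<in> carrier Y \<Longrightarrow>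
          tp x (y \<oplus>\<^bsub>Y\<^esub> y') = tp x y \<oplus>\<^bsub>Z\<^esub> tp x y'"
    and tp_smult_left: "c \<in> K \<Longrightarrow> x \<in> carrier X \<Longrightarrow> y \<in> carrier Y \<Longrightarrow>
          tp (c \<odot>\<^bsub>X\<^esub> x) y = c \<odot>\<^bsub>Z\<^esub> tp x y"
    and tp_smult_right: "c \<in> K \<Longrightarrow> x \<in> carrier X \<Longrightarrow> y \<in> carrier Y \<Longrightarrow>
          tp x (c \<odot>\<^bsub>Y\<^esub> y) = c \<odot>\<^bsub>Z\<^esub> tp x y"
    and ip_tp: "x \<in> carrier X \<Longrightarrow> y \<in> carrier Y \<Longrightarrow> x' \<in> carrier X \<Longrightarrow> y' \<in> carrier Y \<Longrightarrow>
          ip Z (tp x y) (tp x' y') = ip X x x' * ip Y y y'"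
    and dense: "dense_in Z (lin_span K Z {tp x y | x y. x \<in> carrier X \<and> y \<in> carrier Y})"

text \<open>
  The identification of \<open>\<Otimes>\<mu>\<in>I. H \<mu>\<close> with the two-fold product of \<open>\<Otimes>\<mu>\<in>t. H \<mu>\<close> and
  \<open>\<Otimes>\<mu>\<in>I - t. H \<mu>\<close>: elementary tensors are matched with elementary tensors, which makes \<open>tp\<close>
  unique on the carriers.
\<close>

locale tensor_splitting =
  hilbert_tensor K I H T tens +
  left: hilbert_tensor K t H X tens_t +
  right: hilbert_tensor K "I - t" H Y tens_c +
  hilbert_tensor2 K X Y T tp
  for K :: "complex set" and I :: "nat set" and H :: "nat \<Rightarrow> 'a hilb"
    and T :: "'d hilb" and tens :: "(nat \<Rightarrow> 'a) \<Rightarrow> 'd"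
    and t :: "nat set" and X :: "'b hilb" and tens_t :: "(nat \<Rightarrow> 'a) \<Rightarrow> 'b"
    and Y :: "'c hilb" and tens_c :: "(nat \<Rightarrow> 'a) \<Rightarrow> 'c"
    and tp :: "'b \<Rightarrow> 'c \<Rightarrow> 'd" +
  assumes t_subset: "t \<subseteq> I"
    and tens_split: "v \<in> (\<Pi> \<mu>\<in>I. carrier (H \<mu>)) \<Longrightarrow> tens v = tp (tens_t v) (tens_c v)"

text \<open>\<open>C\<close> is the tensor product of the operators \<open>A\<close> and \<open>B\<close>; it is unique on the carrier by density.\<close>

definition is_tensor_op ::
  "complex set \<Rightarrow> 'b hilb \<Rightarrow> 'c hilb \<Rightarrow> 'd hilb \<Rightarrow> ('b \<Rightarrow> 'c \<Rightarrow> 'd) \<Rightarrow>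
   ('b \<Rightarrow> 'b) \<Rightarrow> ('c \<Rightarrow> 'c) \<Rightarrow> ('d \<Rightarrow> 'd) \<Rightarrow> bool" where
  "is_tensor_op K X Y Z tp A B C \<longleftrightarrow>
     bounded_op K Z C \<and>
     (\<forall>x\<in>carrier X. \<forall>y\<in>carrier Y. C (tp x y) = tp (A x) (B y))"


section \<open>Rank and best approximation error\<close>

definition lin_indep :: "complex set \<Rightarrow> 'a hilb \<Rightarrow> 'a set \<Rightarrow> bool" where
  "lin_indep K H B \<longleftrightarrow>
     (\<forall>c\<in>B \<rightarrow> K. (\<Oplus>\<^bsub>H\<^esub>x\<in>B. c x \<odot>\<^bsub>H\<^esub> x) = \<zero>\<^bsub>H\<^esub> \<longrightarrow> (\<forall>x\<in>B. c x = 0))"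

definition hdim :: "complex set \<Rightarrow> 'a hilb \<Rightarrow> 'a set \<Rightarrow> enat" where
  "hdim K H W = Sup {enat (card B) | B. finite B \<and> B \<subseteq> W \<and> lin_indep K H B}"

text \<open>
  The Hilbert-Schmidt operator associated with \<open>v\<close>: it contracts \<open>v\<close> with \<open>y\<close> over the second
  factor, the value being the Riesz representative of \<open>x \<mapsto> \<langle>x \<otimes> y, v\<rangle>\<close>.  In the complex case it
  is conjugate-linear in \<open>y\<close>, i.e. linear on the dual space of \<open>Y\<close>; its range is a linear
  subspace of \<open>X\<close> either way.
\<close>

definition hs_op ::
  "'b hilb \<Rightarrow> 'd hilb \<Rightarrow> ('b \<Rightarrow> 'c \<Rightarrow> 'd) \<Rightarrow> 'd \<Rightarrow> 'c \<Rightarrow> 'b" where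
  "hs_op X Z tp v y =
     (THE x'. x' \<in> carrier X \<and> (\<forall>x\<in>carrier X. ip X x x' = ip Z (tp x y) v))"

definition tensor_rank ::
  "complex set \<Rightarrow> 'b hilb \<Rightarrow> 'c hilb \<Rightarrow> 'd hilb \<Rightarrow> ('b \<Rightarrow> 'c \<Rightarrow> 'd) \<Rightarrow> 'd \<Rightarrow> enat" where
  "tensor_rank K X Y Z tp v = hdim K X (hs_op X Z tp v ` carrier Y)"

text \<open>The infimum is attained (Eckart-Young), so it is the minimum.\<close>

definition best_error ::
  "complex set \<Rightarrow> 'b hilb \<Rightarrow> 'c hilb \<Rightarrow> 'd hilb \<Rightarrow> ('b \<Rightarrow> 'c \<Rightarrow> 'd) \<Rightarrow> nat \<Rightarrow> 'd \<Rightarrow> real" where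
  "best_error K X Y Z tp r u =
     Inf {hdist Z u v | v. v \<in> carrier Z \<and> tensor_rank K X Y Z tp v \<le> enat r}"

end

theory Submission
  imports Defs
begin

text \<open>
  The Richardson iterates \<open>u\<^sub>0 = 0\<close>, \<open>u\<^sub>k\<^sub>+\<^sub>1 = u\<^sub>k + \<omega> (b - A u\<^sub>k)\<close> with \<open>\<omega> = 2 / (\<gamma> + \<Gamma>)\<close> satisfy
  \<open>\<parallel>u - u\<^sub>k\<parallel> \<le> q\<^sup>k \<parallel>u\<parallel>\<close>.  One step turns a sum of \<open>n\<close> elementary tensors into a sum of
  \<open>(r\<^sub>A + 1) n + r\<^sub>b\<close> of them, so \<open>u\<^sub>k\<close> has rank below \<open>(r\<^sub>A + 1)\<^sup>k\<close>.  For given \<open>r\<close>, the largest \<open>k\<close>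
  with \<open>R\<^sup>k \<le> r\<close> gives the bound; since \<open>r\<^sub>b \<le> r\<^sub>A\<close>, every \<open>R \<ge> max 2 (r\<^sub>A + 1)\<close> is admissible.
\<close>

section \<open>Scalar preliminaries: homogeneous linear systems and decay rates\<close>

text \<open>Gaussian elimination removes one equation and one unknown at a time and uses field
  operations only, so the solution stays in the subfield \<open>K\<close>. A set \<open>K\<close>
  instead of a type covers real scalars inside the complex numbers.\<close>

lemma underdetermined_system:
  fixes a :: "nat \<Rightarrow> 'i \<Rightarrow> 'k::field"
  assumes K: "1 \<in> K" "\<And>x y. x \<in> K \<Longrightarrow> y \<in> K \<Longrightarrow> x - y \<in> K"
    "\<And>x y. x \<in> K \<Longrightarrow> y \<in> K \<Longrightarrow> x * y \<in> K" "\<And>x. x \<in> K \<Longrightarrow> inverse x \<in> K"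
    and "finite B" "n < card B" "\<And>i b. i < n \<Longrightarrow> b \<in> B \<Longrightarrow> a i b \<in> K"
  shows "\<exists>c\<in>B \<rightarrow> K. (\<exists>b\<in>B. c b \<noteq> 0) \<and> (\<forall>i<n. (\<Sum>b\<in>B. c b * a i b) = 0)"
  using assms(5-)
proof (induction n arbitrary: a B)
  case 0
  then have "B \<noteq> {}" by auto
  then show ?case using K(1) by (intro bexI[of _ "\<lambda>_. 1"]) auto
next
  case (Suc n)
  show ?case
  proof (cases "\<forall>b\<in>B. a n b = 0")
    case True
    have "\<exists>c\<in>B \<rightarrow> K. (\<exists>b\<in>B. c b \<noteq> 0) \<and> (\<forall>i<n. (\<Sum>b\<in>B. c b * a i b) = 0)"
      using Suc.prems by (intro Suc.IH) auto
    then show ?thesis using True by (auto simp: less_Suc_eq intro!: bexI)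
  next
    case False
    then obtain b0 where b0: "b0 \<in> B" "a n b0 \<noteq> 0" by auto
    define B' where "B' = B - {b0}"
    \<comment> \<open>Equation \<open>n\<close> is the pivot row with pivot \<open>a n b0\<close>;
      \<open>a'\<close> is the system left after eliminating the unknown \<open>b0\<close>.\<close>
    define a' where "a' i b = a i b - a i b0 * (a n b * inverse (a n b0))" for i b
    have B': "finite B'" "b0 \<notin> B'" "B = insert b0 B'"
      using Suc.prems b0 by (auto simp: B'_def)
    have "\<exists>c\<in>B' \<rightarrow> K. (\<exists>b\<in>B'. c b \<noteq> 0) \<and> (\<forall>i<n. (\<Sum>b\<in>B'. c b * a' i b) = 0)"
      using Suc.prems B' b0(1) by (intro Suc.IH) (auto simp: a'_def intro!: K)
    then obtain c b1 where c: "c \<in> B' \<rightarrow> K" "b1 \<in> B'" "c b1 \<noteq> 0"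
      and eq: "\<And>i. i < n \<Longrightarrow> (\<Sum>b\<in>B'. c b * a' i b) = 0" by auto
    define s where "s = (\<Sum>b\<in>B'. c b * a n b)"
    \<comment> \<open>Back substitution: this value of the unknown \<open>b0\<close> solves equation
      \<open>n\<close>. The form \<open>0 - ...\<close> fits the closure of \<open>K\<close> under
      differences.\<close>
    define c' where "c' = c(b0 := 0 - s * inverse (a n b0))"
    have K0: "0 \<in> K" using K(2)[OF K(1) K(1)] by simp
    have Kadd: "x + y \<in> K" if "x \<in> K" "y \<in> K" for x y
      using K(2)[OF that(1) K(2)[OF K0 that(2)]] by simp
    have sum_K: "sum f S \<in> K" if "finite S" "\<And>x. x \<in> S \<Longrightarrow> f x \<in> K" for f :: "'i \<Rightarrow> 'k" and S
      using that by (induction S rule: finite_induct) (auto intro!: Kadd K0)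
    have "s \<in> K"
      unfolding s_def using c(1) B' Suc.prems by (intro sum_K K) auto
    then have "0 - s * inverse (a n b0) \<in> K"
      using Suc.prems(3) b0(1) by (intro K K0) auto
    then have "c' \<in> B \<rightarrow> K"
      using c(1) by (auto simp: c'_def B'(3))
    moreover have "\<exists>b\<in>B. c' b \<noteq> 0"
      using c B' by (intro bexI[of _ b1]) (auto simp: c'_def)
    moreover have "(\<Sum>b\<in>B. c' b * a i b) = 0" if "i < Suc n" for i
    proof -
      have eq1: "(\<Sum>b\<in>B. c' b * a i b) = (\<Sum>b\<in>B'. c b * a i b) - s * inverse (a n b0) * a i b0"
      proof -
        have "(\<Sum>b\<in>B'. c' b * a i b) = (\<Sum>b\<in>B'. c b * a i b)"
          using B' by (intro sum.cong) (auto simp: c'_def)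
        then show ?thesis unfolding B'(3) using B'(1,2) by (simp add: c'_def)
      qed
      show ?thesis
      proof (cases "i = n")
        case True
        then show ?thesis unfolding eq1 using b0 by (simp add: s_def)
      next
        case False
        then have "0 = (\<Sum>b\<in>B'. c b * a' i b)" using eq that by simp
        also have "\<dots> = (\<Sum>b\<in>B'. c b * a i b) - s * inverse (a n b0) * a i b0"
          by (simp add: a'_def s_def right_diff_distrib sum_subtractf sum_distrib_left
              sum_distrib_right algebra_simps)
        finally show ?thesis unfolding eq1 by simp
      qed
    qed
    ultimately show ?thesis by blast
  qed
qed

text \<open>Take \<open>k\<close> with \<open>R ^ k \<le> r < R ^ (k + 1)\<close>. Then
  \<open>k + 1\<close> is at least the logarithm of \<open>r\<close> to base \<open>R\<close>, so
  \<open>q ^ (k + 1)\<close> is at most the stated power of \<open>1 / r\<close>. Writing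
  \<open>q ^ k\<close> as \<open>q ^ (k + 1) / q\<close> produces the factor
  \<open>1 / q\<close>.\<close>

lemma geometric_to_algebraic_decay:
  fixes q N e :: real and R r :: nat
  assumes q: "0 < q" "q < 1" and R: "2 \<le> R" and r: "1 \<le> r" and N: "0 \<le> N"
    and decay: "\<And>k. R ^ k \<le> r \<Longrightarrow> e \<le> q ^ k * N"
  shows "e \<le> N / q * (1 / real r) powr \<bar>ln q / ln (real R)\<bar>"
proof -
  obtain k where k: "R ^ k \<le> r" "r < R ^ (k + 1)"
    using ex_power_ivl1[OF R r] by auto
  have lnR: "0 < ln (real R)" and lnq: "ln q < 0"
    using R q by auto
  have "real r < real R ^ (k + 1)" using k(2) by (metis of_nat_less_iff of_nat_power)
  then have "ln (real r) \<le> ln (real R ^ (k + 1))" using r R by simp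
  also have "\<dots> = real (k + 1) * ln (real R)"
    by (subst ln_realpow) (use R in auto)
  finally have "ln (real r) / ln (real R) \<le> real (k + 1)"
    using lnR by (simp add: field_simps)
  then have "real (k + 1) * ln q \<le> ln (real r) / ln (real R) * ln q"
    using lnq by (intro mult_right_mono_neg) auto
  \<comment> \<open>Two signs cancel: the quotient in the absolute value is negative, and
    \<open>ln (1 / r) = - ln r\<close>.\<close>
  moreover have "\<bar>ln q / ln (real R)\<bar> * ln (1 / real r) = ln (real r) / ln (real R) * ln q"
    using lnR lnq r by (simp add: abs_div_pos[symmetric] ln_div)
  ultimately have "exp (real (k + 1) * ln q) \<le> (1 / real r) powr \<bar>ln q / ln (real R)\<bar>"
    using r by (simp add: powr_def)
  then have "q ^ (k + 1) \<le> (1 / real r) powr \<bar>ln q / ln (real R)\<bar>"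
    using q by (simp add: exp_of_nat_mult del: of_nat_Suc of_nat_add power_Suc)
  then have "N / q * q ^ (k + 1) \<le> N / q * (1 / real r) powr \<bar>ln q / ln (real R)\<bar>"
    using N q by (intro mult_left_mono) auto
  moreover have "e \<le> N / q * q ^ (k + 1)" using decay[OF k(1)] q by (simp add: mult.commute)
  ultimately show ?thesis by linarith
qed

section \<open>Inner product calculus and the contraction estimate in one Hilbert space\<close>

context hilbert_space
begin

lemma carrier_scalars [simp]: "carrier (scalars K) = K"
  by (simp add: scalars_def)

lemma smult_mem [simp, intro]: "c \<in> K \<Longrightarrow> x \<in> carrier H \<Longrightarrow> c \<odot> x \<in> carrier H"
  using smult_closed by simp

lemma of_real_mem [simp, intro]: "of_real c \<in> K"
  using real_or_complex by auto

lemma ip_add_left: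
  assumes "x \<in> carrier H" "y \<in> carrier H" "z \<in> carrier H"
  shows "ip H (x \<oplus> y) z = ip H x z + ip H y z"
  using assms by (metis a_closed complex_cnj_add ip_add_right ip_commute)

lemma ip_smult_left:
  assumes "c \<in> K" "x \<in> carrier H" "y \<in> carrier H"
  shows "ip H (c \<odot> x) y = cnj c * ip H x y"
  using assms by (metis complex_cnj_mult ip_commute ip_smult_right smult_mem)

lemma ip_zero_right [simp]: "x \<in> carrier H \<Longrightarrow> ip H x \<zero> = 0"
  using ip_add_right[of x \<zero> \<zero>] by simp

lemma ip_minus_right:
  assumes "x \<in> carrier H" "y \<in> carrier H"
  shows "ip H x (\<ominus> y) = - ip H x y"
  using ip_add_right[of x y "\<ominus> y"] assms by (simp add: r_neg add_eq_0_iff)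

lemma ip_self_nonneg: "x \<in> carrier H \<Longrightarrow> 0 \<le> Re (ip H x x)"
  by (cases "x = \<zero>") (auto simp: less_imp_le[OF ip_pos])

lemma hnorm_nonneg: "x \<in> carrier H \<Longrightarrow> 0 \<le> hnorm H x"
  by (simp add: hnorm_def ip_self_nonneg)

lemma hnorm_sq: "x \<in> carrier H \<Longrightarrow> (hnorm H x)\<^sup>2 = Re (ip H x x)"
  by (simp add: hnorm_def ip_self_nonneg)

lemma hdist_nonneg: "x \<in> carrier H \<Longrightarrow> y \<in> carrier H \<Longrightarrow> 0 \<le> hdist H x y"
  by (simp add: hdist_def hnorm_nonneg)

text \<open>Testing with \<open>z = x - y\<close> and definiteness give the claim. It reduces vector
  identities to identities between complex numbers.\<close>

lemma ip_eqI:
  assumes "x \<in> carrier H" "y \<in> carrier H"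
    and eq: "\<And>z. z \<in> carrier H \<Longrightarrow> ip H z x = ip H z y"
  shows "x = y"
proof -
  have "ip H (x \<ominus> y) (x \<ominus> y) = 0"
    using assms(1,2) eq[of "x \<ominus> y"]
    by (simp add: minus_eq ip_add_right ip_minus_right)
  then have "x \<ominus> y = \<zero>"
    using ip_pos[of "x \<ominus> y"] assms(1,2) by force
  then show ?thesis using assms(1,2) minus_equality[of x "\<ominus> y"] by (simp add: minus_eq)
qed

lemma ip_finsum_right:
  assumes "finite S" "x \<in> carrier H" "f \<in> S \<rightarrow> carrier H"
  shows "ip H x (\<Oplus>i\<in>S. f i) = (\<Sum>i\<in>S. ip H x (f i))"
  using assms(1,3) by (induction S rule: finite_induct)
    (auto simp: assms(2) ip_add_right Pi_iff finsum_closed)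

text \<open>
  The estimate is \<open>\<langle>v, (\<Gamma> - A) (A - \<gamma>) v\<rangle> \<ge> 0\<close>, obtained without square roots of operators from
  the upper bound at \<open>A v - \<gamma> v\<close> and the lower bound at \<open>\<Gamma> v - A v\<close>.
\<close>
lemma richardson_contraction:
  fixes \<gamma> \<Gamma> :: real
  assumes A: "self_adjoint_op K H A" and \<gamma>: "0 < \<gamma>" "\<gamma> < \<Gamma>"
    and lo: "\<And>v. v \<in> carrier H \<Longrightarrow> \<gamma> * (hnorm H v)\<^sup>2 \<le> Re (ip H v (A v))"
    and up: "\<And>v. v \<in> carrier H \<Longrightarrow> Re (ip H v (A v)) \<le> \<Gamma> * (hnorm H v)\<^sup>2"
    and v: "v \<in> carrier H"
  shows "hnorm H (v \<ominus> of_real (2 / (\<gamma> + \<Gamma>)) \<odot> A v) \<le> (\<Gamma> - \<gamma>) / (\<Gamma> + \<gamma>) * hnorm H v"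
proof -
  have cl [simp]: "\<And>x. x \<in> carrier H \<Longrightarrow> A x \<in> carrier H"
    and add: "\<And>x y. x \<in> carrier H \<Longrightarrow> y \<in> carrier H \<Longrightarrow> A (x \<oplus> y) = A x \<oplus> A y"
    and sm: "\<And>c x. c \<in> K \<Longrightarrow> x \<in> carrier H \<Longrightarrow> A (c \<odot> x) = c \<odot> A x"
    and sa: "\<And>x y. x \<in> carrier H \<Longrightarrow> y \<in> carrier H \<Longrightarrow> ip H (A x) y = ip H x (A y)"
    using A by (auto simp: self_adjoint_op_def bounded_op_def)
  \<comment> \<open>The moments of \<open>A\<close> at \<open>v\<close> of orders 0 to 3. By
    self-adjointness every quadratic form on the span of \<open>v\<close> and \<open>A v\<close>
    that occurs below is a combination of them.\<close>
  define a p s m where "a = Re (ip H v v)" "p = Re (ip H v (A v))"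
    "s = Re (ip H v (A (A v)))" "m = Re (ip H v (A (A (A v))))"
  note defs = this
  define z where "z \<alpha> \<beta> = of_real \<alpha> \<odot> v \<oplus> of_real \<beta> \<odot> A v" for \<alpha> \<beta> :: real
  have z: "z \<alpha> \<beta> \<in> carrier H" for \<alpha> \<beta> using v by (simp add: z_def)
  have norm_z: "(hnorm H (z \<alpha> \<beta>))\<^sup>2 = \<alpha>\<^sup>2 * a + 2 * \<alpha> * \<beta> * p + \<beta>\<^sup>2 * s" for \<alpha> \<beta>
    unfolding hnorm_sq[OF z] using v
    by (simp add: z_def defs ip_add_left ip_add_right ip_smult_left ip_smult_right sa
        algebra_simps power2_eq_square)
  have form_z: "Re (ip H (z \<alpha> \<beta>) (A (z \<alpha> \<beta>))) = \<alpha>\<^sup>2 * p + 2 * \<alpha> * \<beta> * s + \<beta>\<^sup>2 * m" for \<alpha> \<beta>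
    using v
    by (simp add: z_def defs add sm ip_add_left ip_add_right ip_smult_left ip_smult_right sa
        algebra_simps power2_eq_square)
  have "\<gamma>\<^sup>2 * p - 2 * \<gamma> * s + m \<le> \<Gamma> * (\<gamma>\<^sup>2 * a - 2 * \<gamma> * p + s)"
    using up[OF z[of "-\<gamma>" 1]] unfolding norm_z form_z by simp
  moreover have "\<gamma> * (\<Gamma>\<^sup>2 * a - 2 * \<Gamma> * p + s) \<le> \<Gamma>\<^sup>2 * p - 2 * \<Gamma> * s + m"
    using lo[OF z[of \<Gamma> "-1"]] unfolding norm_z form_z by simp
  \<comment> \<open>Adding the two bounds cancels the third moment \<open>m\<close> and leaves the
    common factor \<open>\<Gamma> - \<gamma>\<close>.\<close>
  ultimately have "(\<Gamma> - \<gamma>) * s \<le> (\<Gamma> - \<gamma>) * ((\<Gamma> + \<gamma>) * p - \<gamma> * \<Gamma> * a)"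
    by (simp add: algebra_simps power2_eq_square)
  then have s: "s \<le> (\<Gamma> + \<gamma>) * p - \<gamma> * \<Gamma> * a" using \<gamma> by simp
  define c where "c = \<gamma> + \<Gamma>"
  have c: "0 < c" using \<gamma> by (simp add: c_def)
  have "v \<ominus> of_real (2 / c) \<odot> A v = z 1 (- (2 / c))"
  proof (rule ip_eqI)
    show "ip H w (v \<ominus> of_real (2 / c) \<odot> A v) = ip H w (z 1 (- (2 / c)))" if "w \<in> carrier H" for w
      using v that by (simp add: z_def minus_eq ip_add_right ip_minus_right ip_smult_right
          del: of_real_divide of_real_1 of_real_minus) simp
    show "v \<ominus> of_real (2 / c) \<odot> A v \<in> carrier H"
      by (intro minus_closed smult_mem of_real_mem cl v)
  qed (rule z)
  then have "(hnorm H (v \<ominus> of_real (2 / c) \<odot> A v))\<^sup>2 = a - 4 / c * p + 4 / c\<^sup>2 * s"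
    by (simp add: norm_z power_divide)
  also have "\<dots> \<le> a - 4 / c * p + 4 / c\<^sup>2 * (c * p - \<gamma> * \<Gamma> * a)"
    using s by (intro add_left_mono mult_left_mono) (auto simp: c_def add.commute)
  \<comment> \<open>The step size \<open>2 / c\<close> is the one for which the terms in
    \<open>p\<close> cancel; what remains is a square because \<open>c\<^sup>2 - 4 * \<gamma> *
    \<Gamma> = (\<Gamma> - \<gamma>)\<^sup>2\<close>.\<close>
  also have "\<dots> = (c\<^sup>2 - 4 * \<gamma> * \<Gamma>) / c\<^sup>2 * a"
    using c by (simp add: field_simps power2_eq_square)
  also have "\<dots> = ((\<Gamma> - \<gamma>) / c * hnorm H v)\<^sup>2"
    by (simp add: power_mult_distrib power_divide hnorm_sq v defs)
       (simp add: c_def power2_eq_square algebra_simps)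
  finally show ?thesis
    using power2_le_imp_le[of "hnorm H (v \<ominus> of_real (2 / c) \<odot> A v)" "(\<Gamma> - \<gamma>) / c * hnorm H v"]
      \<gamma> c hnorm_nonneg[OF v] by (simp add: c_def add.commute)
qed

end

section \<open>Finite sums of elementary tensors in a two-fold product\<close>

context hilbert_tensor2
begin

text \<open>The index counts the terms of one representation, which may be zero or dependent. It is
  only an upper bound for the rank, but it is additive under sums.\<close>

inductive tensor_sum :: "nat \<Rightarrow> 'd \<Rightarrow> bool" where
  zero: "tensor_sum 0 \<zero>\<^bsub>Z\<^esub>"
| add: "tensor_sum n v \<Longrightarrow> x \<in> carrier X \<Longrightarrow> y \<in> carrier Y \<Longrightarrow>
    tensor_sum (Suc n) (v \<oplus>\<^bsub>Z\<^esub> tp x y)"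

lemma tensor_sum_closed: "tensor_sum n v \<Longrightarrow> v \<in> carrier Z"
  by (induction rule: tensor_sum.induct) (auto intro: tp_closed)

lemma tensor_sum_tp:
  assumes "x \<in> carrier X" "y \<in> carrier Y"
  shows "tensor_sum 1 (tp x y)"
  using tensor_sum.add[OF tensor_sum.zero assms] tp_closed[OF assms] by simp

lemma tensor_sum_plus:
  assumes "tensor_sum m w" "tensor_sum n v"
  shows "tensor_sum (n + m) (v \<oplus>\<^bsub>Z\<^esub> w)"
  using assms(1)
proof (induction rule: tensor_sum.induct)
  case zero
  then show ?case using assms(2) tensor_sum_closed[OF assms(2)] by simp
next
  case (add m w x y)
  then show ?case
    using tensor_sum.add[OF add.IH add.hyps(2,3)] tensor_sum_closed[OF assms(2)]
      tensor_sum_closed[OF add.hyps(1)]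
    by (simp add: Z.a_assoc tp_closed)
qed

lemma tensor_sum_finsum:
  assumes "finite S" "\<And>i. i \<in> S \<Longrightarrow> tensor_sum n (f i)"
  shows "tensor_sum (card S * n) (\<Oplus>\<^bsub>Z\<^esub>i\<in>S. f i)"
  using assms
proof (induction S rule: finite_induct)
  case empty
  then show ?case by (simp add: tensor_sum.zero)
next
  case (insert i S)
  have "f \<in> S \<rightarrow> carrier Z" "f i \<in> carrier Z"
    using insert.prems tensor_sum_closed by auto
  then show ?case
    using insert tensor_sum_plus[of "card S * n" "\<Oplus>\<^bsub>Z\<^esub>i\<in>S. f i" n "f i"] by simp
qed

text \<open>Common source of the term counts for scalar multiples and for tensor products of
  operators. Additivity of \<open>f\<close> suffices, since the terms carry no separate
  coefficients.\<close>

lemma tensor_sum_image: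
  assumes "tensor_sum n v" and f: "f \<in> carrier Z \<rightarrow> carrier Z"
    and add: "\<And>v w. v \<in> carrier Z \<Longrightarrow> w \<in> carrier Z \<Longrightarrow> f (v \<oplus>\<^bsub>Z\<^esub> w) = f v \<oplus>\<^bsub>Z\<^esub> f w"
    and tp: "\<And>x y. x \<in> carrier X \<Longrightarrow> y \<in> carrier Y \<Longrightarrow> f (tp x y) = tp (g x) (h y)"
    and g: "g \<in> carrier X \<rightarrow> carrier X" and h: "h \<in> carrier Y \<rightarrow> carrier Y"
  shows "tensor_sum n (f v)"
  using assms(1)
proof (induction rule: tensor_sum.induct)
  case zero
  have "f \<zero>\<^bsub>Z\<^esub> \<in> carrier Z" using f by auto
  moreover have "f \<zero>\<^bsub>Z\<^esub> \<oplus>\<^bsub>Z\<^esub> f \<zero>\<^bsub>Z\<^esub> = f \<zero>\<^bsub>Z\<^esub>"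
    using add[of "\<zero>\<^bsub>Z\<^esub>" "\<zero>\<^bsub>Z\<^esub>"] by simp
  ultimately have "f \<zero>\<^bsub>Z\<^esub> = \<zero>\<^bsub>Z\<^esub>" by simp
  then show ?case by (simp add: tensor_sum.zero)
next
  case (add n v x y)
  then have "g x \<in> carrier X" "h y \<in> carrier Y" using g h by auto
  then have "tensor_sum (Suc n) (f v \<oplus>\<^bsub>Z\<^esub> tp (g x) (h y))"
    by (intro tensor_sum.add add.IH)
  then show ?case
    using add.hyps assms(3)[OF tensor_sum_closed[OF add.hyps(1)] tp_closed] tp by simp
qed

lemma tensor_sum_smult:
  assumes "tensor_sum n v" "c \<in> K"
  shows "tensor_sum n (c \<odot>\<^bsub>Z\<^esub> v)"
  by (rule tensor_sum_image[where g = "\<lambda>x. c \<odot>\<^bsub>X\<^esub> x" and h = "\<lambda>y. y"])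
    (use assms in \<open>auto simp: tp_smult_left Z.smult_r_distr\<close>)

lemma tensor_sum_tensor_op:
  assumes "tensor_sum n v" "is_tensor_op K X Y Z tp A B C"
    and "bounded_op K X A" "bounded_op K Y B"
  shows "tensor_sum n (C v)"
  by (rule tensor_sum_image[where g = A and h = B])
    (use assms in \<open>auto simp: is_tensor_op_def bounded_op_def\<close>)

section \<open>Contraction operator and rank of a finite tensor sum\<close>

text \<open>For \<open>v\<close> the sum of the \<open>tp (x i) (y i)\<close>, the representative is
  explicit: the sum of the \<open>x i\<close> with coefficients \<open>ip Y y (y i)\<close>.\<close>

lemma tensor_sum_contraction:
  assumes "tensor_sum n v" "y \<in> carrier Y"
  shows "\<exists>x'\<in>carrier X. \<forall>x\<in>carrier X. ip X x x' = ip Z (tp x y) v"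
  using assms(1)
proof (induction rule: tensor_sum.induct)
  case zero
  then show ?case using assms(2) by (intro bexI[of _ "\<zero>\<^bsub>X\<^esub>"]) (auto simp: tp_closed)
next
  case (add n v x1 y1)
  then obtain x' where "x' \<in> carrier X" "\<forall>x\<in>carrier X. ip X x x' = ip Z (tp x y) v" by auto
  then show ?case
    using add.hyps assms(2) tensor_sum_closed[OF add.hyps(1)]
    by (intro bexI[of _ "x' \<oplus>\<^bsub>X\<^esub> ip Y y y1 \<odot>\<^bsub>X\<^esub> x1"])
      (auto simp: X.ip_add_right X.ip_smult_right Z.ip_add_right Y.ip_closed tp_closed ip_tp)
qed

text \<open>The definite description in \<open>hs_op\<close> denotes: a representative was just
  exhibited, and its inner products with all \<open>x\<close> determine it.\<close>

lemma hs_op_tensor_sum: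
  assumes "tensor_sum n v" "y \<in> carrier Y"
  shows "hs_op X Z tp v y \<in> carrier X \<and>
    (\<forall>x\<in>carrier X. ip X x (hs_op X Z tp v y) = ip Z (tp x y) v)"
  unfolding hs_op_def
proof (rule theI')
  show "\<exists>!x'. x' \<in> carrier X \<and> (\<forall>x\<in>carrier X. ip X x x' = ip Z (tp x y) v)"
    using tensor_sum_contraction[OF assms] by (auto intro!: X.ip_eqI)
qed

lemma ip_tensor_sum:
  assumes "tensor_sum n v"
  shows "\<exists>\<xi> \<eta>. (\<forall>i<n. \<xi> i \<in> carrier X \<and> \<eta> i \<in> carrier Y) \<and>
    (\<forall>x\<in>carrier X. \<forall>y\<in>carrier Y. ip Z (tp x y) v = (\<Sum>i<n. ip X x (\<xi> i) * ip Y y (\<eta> i)))"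
  using assms
proof (induction rule: tensor_sum.induct)
  case zero
  then show ?case by (auto simp: tp_closed)
next
  case (add n v x1 y1)
  then obtain \<xi> \<eta> where "\<forall>i<n. \<xi> i \<in> carrier X \<and> \<eta> i \<in> carrier Y"
    "\<forall>x\<in>carrier X. \<forall>y\<in>carrier Y. ip Z (tp x y) v = (\<Sum>i<n. ip X x (\<xi> i) * ip Y y (\<eta> i))" by auto
  then show ?case
    using add.hyps tensor_sum_closed[OF add.hyps(1)]
    by (intro exI[of _ "\<xi>(n := x1)"] exI[of _ "\<eta>(n := y1)"])
      (auto simp: Z.ip_add_right tp_closed ip_tp)
qed

text \<open>The range of the contraction operator is spanned by the \<open>n\<close> left factors
  \<open>\<xi> i\<close>. Concretely, a dependency among more than \<open>n\<close> vectors of the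
  range comes from solving \<open>n\<close> homogeneous equations, one for each right factor
  \<open>\<eta> i\<close>.\<close>

lemma tensor_rank_le:
  assumes "tensor_sum n v"
  shows "tensor_rank K X Y Z tp v \<le> enat n"
  unfolding tensor_rank_def hdim_def
proof (rule Sup_least, clarify)
  fix B
  assume B: "finite B" "B \<subseteq> hs_op X Z tp v ` carrier Y" "lin_indep K X B"
  obtain \<xi> \<eta> where \<xi>: "\<And>i. i < n \<Longrightarrow> \<xi> i \<in> carrier X" and \<eta>: "\<And>i. i < n \<Longrightarrow> \<eta> i \<in> carrier Y"
    and v: "\<And>x y. x \<in> carrier X \<Longrightarrow> y \<in> carrier Y \<Longrightarrow>
      ip Z (tp x y) v = (\<Sum>i<n. ip X x (\<xi> i) * ip Y y (\<eta> i))"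
    using ip_tensor_sum[OF assms] by blast
  \<comment> \<open>\<open>g\<close> picks preimages of the vectors of \<open>B\<close> under the
    contraction operator.\<close>
  obtain g where g: "\<And>b. b \<in> B \<Longrightarrow> g b \<in> carrier Y" "\<And>b. b \<in> B \<Longrightarrow> hs_op X Z tp v (g b) = b"
    using B(2) by (metis (no_types, lifting) f_inv_into_f inv_into_into subsetD)
  have BX: "b \<in> carrier X" if "b \<in> B" for b
    using hs_op_tensor_sum[OF assms g(1)[OF that]] g(2)[OF that] by simp
  have ip_B: "ip X x b = (\<Sum>i<n. ip X x (\<xi> i) * ip Y (g b) (\<eta> i))"
    if "x \<in> carrier X" "b \<in> B" for x b
    using hs_op_tensor_sum[OF assms g(1)[OF that(2)]] g[OF that(2)] v that by simp
  show "enat (card B) \<le> enat n"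
  proof (rule ccontr)
    assume "\<not> ?thesis"
    then have n: "n < card B" by simp
    have "\<exists>c\<in>B \<rightarrow> K. (\<exists>b\<in>B. c b \<noteq> 0) \<and> (\<forall>i<n. (\<Sum>b\<in>B. c b * ip Y (g b) (\<eta> i)) = 0)"
      using X.real_or_complex B(1) n g(1) \<eta> Y.ip_closed
      by (intro underdetermined_system) auto
    then obtain c where c: "c \<in> B \<rightarrow> K" "\<exists>b\<in>B. c b \<noteq> 0"
      "\<And>i. i < n \<Longrightarrow> (\<Sum>b\<in>B. c b * ip Y (g b) (\<eta> i)) = 0" by auto
    have cB: "(\<lambda>b. c b \<odot>\<^bsub>X\<^esub> b) \<in> B \<rightarrow> carrier X" using c(1) BX by auto
    have "(\<Oplus>\<^bsub>X\<^esub>b\<in>B. c b \<odot>\<^bsub>X\<^esub> b) = \<zero>\<^bsub>X\<^esub>"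
    proof (rule X.ip_eqI)
      fix x assume x: "x \<in> carrier X"
      have "ip X x (\<Oplus>\<^bsub>X\<^esub>b\<in>B. c b \<odot>\<^bsub>X\<^esub> b) = (\<Sum>b\<in>B. c b * ip X x b)"
        using c(1) BX x by (auto simp: X.ip_finsum_right[OF B(1) x cB] X.ip_smult_right Pi_iff
            intro!: sum.cong)
      also have "\<dots> = (\<Sum>b\<in>B. \<Sum>i<n. ip X x (\<xi> i) * (c b * ip Y (g b) (\<eta> i)))"
        using x by (intro sum.cong) (auto simp: ip_B sum_distrib_left algebra_simps)
      \<comment> \<open>After the exchange of sums each inner sum is the left side of an equation
        solved by \<open>c\<close>.\<close>
      also have "\<dots> = (\<Sum>i<n. ip X x (\<xi> i) * (\<Sum>b\<in>B. c b * ip Y (g b) (\<eta> i)))"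
        by (subst sum.swap) (simp add: sum_distrib_left)
      also have "\<dots> = ip X x \<zero>\<^bsub>X\<^esub>" using c(3) x by simp
      finally show "ip X x (\<Oplus>\<^bsub>X\<^esub>b\<in>B. c b \<odot>\<^bsub>X\<^esub> b) = ip X x \<zero>\<^bsub>X\<^esub>" .
    qed (use cB X.finsum_closed in auto)
    then show False using B(3) c(1,2) unfolding lin_indep_def by blast
  qed
qed

section \<open>Approximation error of the Richardson iterates\<close>

lemma best_error_le:
  assumes "u \<in> carrier Z" "tensor_sum n v" "n \<le> r"
  shows "best_error K X Y Z tp r u \<le> hdist Z u v"
  unfolding best_error_def
proof (rule cInf_lower)
  have "tensor_rank K X Y Z tp v \<le> enat r"
    using tensor_rank_le[OF assms(2)] assms(3) by (meson enat_ord_simps(1) order_trans)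
  then show "hdist Z u v \<in> {hdist Z u v |v. v \<in> carrier Z \<and> tensor_rank K X Y Z tp v \<le> enat r}"
    using tensor_sum_closed[OF assms(2)] by blast
  show "bdd_below {hdist Z u v |v. v \<in> carrier Z \<and> tensor_rank K X Y Z tp v \<le> enat r}"
    using Z.hdist_nonneg[OF assms(1)] by (intro bdd_belowI[of _ 0]) auto
qed

text \<open>The strict bound on \<open>n\<close> is what makes the induction close: it leaves room
  for one more term, and \<open>(rA + 1) * (n + 1)\<close> then absorbs the \<open>rb\<close> terms
  of the right-hand side. The start is the zero tensor, with
  \<open>0 < (rA + 1) ^ 0\<close>.\<close>

lemma richardson_approximation:
  fixes \<gamma> \<Gamma> :: real
  assumes A: "self_adjoint_op K Z A" and \<gamma>: "0 < \<gamma>" "\<gamma> < \<Gamma>"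
    and lo: "\<And>v. v \<in> carrier Z \<Longrightarrow> \<gamma> * (hnorm Z v)\<^sup>2 \<le> Re (ip Z v (A v))"
    and up: "\<And>v. v \<in> carrier Z \<Longrightarrow> Re (ip Z v (A v)) \<le> \<Gamma> * (hnorm Z v)\<^sup>2"
    and rank_A: "\<And>n v. tensor_sum n v \<Longrightarrow> tensor_sum (rA * n) (A v)"
    and u: "u \<in> carrier Z" and rank_b: "tensor_sum rb (A u)" and "rb \<le> rA"
  shows "\<exists>n v. tensor_sum n v \<and> n < (rA + 1) ^ k \<and>
    hdist Z u v \<le> ((\<Gamma> - \<gamma>) / (\<Gamma> + \<gamma>)) ^ k * hnorm Z u"
proof (induction k)
  case 0
  have "u \<ominus>\<^bsub>Z\<^esub> \<zero>\<^bsub>Z\<^esub> = u" using u by (simp add: Z.minus_eq)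
  then show ?case using tensor_sum.zero by (force simp: hdist_def)
next
  case (Suc k)
  then obtain n v where v: "tensor_sum n v" "n < (rA + 1) ^ k"
    "hdist Z u v \<le> ((\<Gamma> - \<gamma>) / (\<Gamma> + \<gamma>)) ^ k * hnorm Z u" by auto
  have vZ: "v \<in> carrier Z" by (rule tensor_sum_closed[OF v(1)])
  have cl [simp]: "\<And>x. x \<in> carrier Z \<Longrightarrow> A x \<in> carrier Z"
    and add: "\<And>x y. x \<in> carrier Z \<Longrightarrow> y \<in> carrier Z \<Longrightarrow> A (x \<oplus>\<^bsub>Z\<^esub> y) = A x \<oplus>\<^bsub>Z\<^esub> A y"
    and sm: "\<And>c x. c \<in> K \<Longrightarrow> x \<in> carrier Z \<Longrightarrow> A (c \<odot>\<^bsub>Z\<^esub> x) = c \<odot>\<^bsub>Z\<^esub> A x"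
    using A by (auto simp: self_adjoint_op_def bounded_op_def)
  \<comment> \<open>At this step size \<open>1 - \<omega> * x\<close> has the same absolute value,
    the contraction factor, at both ends of the interval from \<open>\<gamma>\<close> to
    \<open>\<Gamma>\<close>.\<close>
  define \<omega> where "\<omega> = 2 / (\<gamma> + \<Gamma>)"
  \<comment> \<open>One Richardson step, with \<open>A u\<close> for the right-hand side and
    subtraction written as a multiple by \<open>-1\<close>, so that the term counts for sums and
    scalar multiples apply.\<close>
  define w where "w = v \<oplus>\<^bsub>Z\<^esub> of_real \<omega> \<odot>\<^bsub>Z\<^esub> (A u \<oplus>\<^bsub>Z\<^esub> of_real (- 1) \<odot>\<^bsub>Z\<^esub> A v)"
  have "tensor_sum (n + (rb + rA * n)) w"
    unfolding w_def by (intro tensor_sum_plus tensor_sum_smult v rank_A rank_b Z.of_real_mem)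
  moreover have "n + (rb + rA * n) < (rA + 1) ^ Suc k"
  proof -
    have "n + (rb + rA * n) < (rA + 1) * (n + 1)" using \<open>rb \<le> rA\<close> by simp
    also have "\<dots> \<le> (rA + 1) * (rA + 1) ^ k" using v(2) by (intro mult_le_mono2) simp
    finally show ?thesis by simp
  qed
  moreover have "hdist Z u w \<le> ((\<Gamma> - \<gamma>) / (\<Gamma> + \<gamma>)) ^ Suc k * hnorm Z u"
  proof -
    define e where "e = u \<oplus>\<^bsub>Z\<^esub> of_real (- 1) \<odot>\<^bsub>Z\<^esub> v"
    have neg: "of_real (- 1) \<odot>\<^bsub>Z\<^esub> x = \<ominus>\<^bsub>Z\<^esub> x" if "x \<in> carrier Z" for x
    proof (rule Z.ip_eqI)
      show "ip Z z (of_real (- 1) \<odot>\<^bsub>Z\<^esub> x) = ip Z z (\<ominus>\<^bsub>Z\<^esub> x)" if "z \<in> carrier Z" for z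
        using that \<open>x \<in> carrier Z\<close> Z.ip_smult_right[OF Z.of_real_mem[of "-1"]]
        by (simp add: Z.ip_minus_right)
    qed (use that in \<open>simp_all del: of_real_minus\<close>)
    have e: "e \<in> carrier Z" "e = u \<ominus>\<^bsub>Z\<^esub> v"
      using u vZ neg[OF vZ] unfolding e_def by (auto simp: Z.minus_eq simp del: of_real_minus)
    have Ae: "A e = A u \<oplus>\<^bsub>Z\<^esub> of_real (- 1) \<odot>\<^bsub>Z\<^esub> A v"
      unfolding e_def using u vZ add sm Z.of_real_mem Z.smult_mem by metis
    \<comment> \<open>The residual is \<open>A e\<close>, so the new error is the old one after a
      step of the homogeneous iteration.\<close>
    have "u \<ominus>\<^bsub>Z\<^esub> w = e \<ominus>\<^bsub>Z\<^esub> of_real \<omega> \<odot>\<^bsub>Z\<^esub> A e"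
      unfolding w_def Ae[symmetric] e(2) using u vZ e(1)[unfolded e(2)]
      by (simp add: Z.minus_eq Z.minus_add Z.a_ac)
    then have "hdist Z u w \<le> (\<Gamma> - \<gamma>) / (\<Gamma> + \<gamma>) * hdist Z u v"
      using Z.richardson_contraction[OF A \<gamma> lo up e(1)] by (simp add: hdist_def e(2) \<omega>_def)
    also have "\<dots> \<le> (\<Gamma> - \<gamma>) / (\<Gamma> + \<gamma>) * (((\<Gamma> - \<gamma>) / (\<Gamma> + \<gamma>)) ^ k * hnorm Z u)"
      using v(3) \<gamma> by (intro mult_left_mono) auto
    finally show ?thesis by (simp add: mult.assoc)
  qed
  ultimately show ?case by blast
qed

end

section \<open>Assembly of the bounds for both values of \<open>R\<close>\<close>

theorem theorem2:
  fixes K :: "complex set" and d :: nat and H :: "nat \<Rightarrow> 'a hilb"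
    and HH :: "'d hilb" and tens :: "(nat \<Rightarrow> 'a) \<Rightarrow> 'd"
    and t :: "nat set"
    and Ht :: "'b hilb" and tens_t :: "(nat \<Rightarrow> 'a) \<Rightarrow> 'b"
    and Hc :: "'c hilb" and tens_c :: "(nat \<Rightarrow> 'a) \<Rightarrow> 'c"
    and tp :: "'b \<Rightarrow> 'c \<Rightarrow> 'd"
    and A :: "'d \<Rightarrow> 'd" and \<gamma> \<Gamma> \<kappa> q :: real
    and rA rb :: nat
    and At :: "nat \<Rightarrow> 'b \<Rightarrow> 'b" and Ac :: "nat \<Rightarrow> 'c \<Rightarrow> 'c" and AA :: "nat \<Rightarrow> 'd \<Rightarrow> 'd"
    and bt :: "nat \<Rightarrow> 'b" and bc :: "nat \<Rightarrow> 'c" and b u :: 'd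
  assumes "K = \<real> \<or> K = UNIV"
    and "d \<ge> 2"
    and "t \<subseteq> {1..d}" and "0 < card t" and "card t < d"
    and "tensor_splitting K {1..d} H HH tens t Ht tens_t Hc tens_c tp"
    and "self_adjoint_op K HH A"
    and "0 < \<gamma>" and "\<gamma> < \<Gamma>"
    and "\<And>v. v \<in> carrier HH \<Longrightarrow> \<gamma> * (hnorm HH v)\<^sup>2 \<le> Re (ip HH v (A v))"
    and "\<And>v. v \<in> carrier HH \<Longrightarrow> Re (ip HH v (A v)) \<le> \<Gamma> * (hnorm HH v)\<^sup>2"
    and "\<And>i. i \<in> {1..rA} \<Longrightarrow> bounded_op K Ht (At i)"
    and "\<And>i. i \<in> {1..rA} \<Longrightarrow> bounded_op K Hc (Ac i)"
    and "\<And>i. i \<in> {1..rA} \<Longrightarrow> is_tensor_op K Ht Hc HH tp (At i) (Ac i) (AA i)"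
    and "\<And>v. v \<in> carrier HH \<Longrightarrow> A v = (\<Oplus>\<^bsub>HH\<^esub>i\<in>{1..rA}. AA i v)"
    and "\<And>j. j \<in> {1..rb} \<Longrightarrow> bt j \<in> carrier Ht"
    and "\<And>j. j \<in> {1..rb} \<Longrightarrow> bc j \<in> carrier Hc"
    and "b = (\<Oplus>\<^bsub>HH\<^esub>j\<in>{1..rb}. tp (bt j) (bc j))"
    and "rb \<le> rA"
    and "\<kappa> = \<Gamma> / \<gamma>" and "q = (\<kappa> - 1) / (\<kappa> + 1)"
    and "u \<in> carrier HH" and "A u = b"
  shows "(\<forall>r\<ge>1. best_error K Ht Hc HH tp r u
            \<le> hnorm HH u / q * (1 / real r) powr \<bar>ln q / ln (real (rA + 2))\<bar>) \<and>
         ((\<exists>i\<in>{1..rA}. (\<forall>x\<in>carrier Ht. At i x = x) \<or> (\<forall>y\<in>carrier Hc. Ac i y = y)) \<longrightarrow>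
          (\<forall>r\<ge>1. best_error K Ht Hc HH tp r u
            \<le> hnorm HH u / q * (1 / real r) powr \<bar>ln q / ln (real (rA + 1))\<bar>))"
proof -
  interpret hilbert_tensor2 K Ht Hc HH tp
    using assms(6) by (simp add: tensor_splitting_def)
  have rank_A: "tensor_sum (rA * n) (A v)" if "tensor_sum n v" for n v
  proof -
    have "tensor_sum n (AA i v)" if "i \<in> {1..rA}" for i
      using tensor_sum_tensor_op[OF \<open>tensor_sum n v\<close> assms(14,12,13)] that by blast
    then show ?thesis
      using tensor_sum_finsum[of "{1..rA}" n "\<lambda>i. AA i v"] assms(15)[OF tensor_sum_closed[OF that]]
      by simp
  qed
  have rank_b: "tensor_sum rb (A u)"
    using tensor_sum_finsum[of "{1..rb}" 1 "\<lambda>j. tp (bt j) (bc j)"] tensor_sum_tp assms(16-18)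
      \<open>A u = b\<close> by simp
  have q: "q = (\<Gamma> - \<gamma>) / (\<Gamma> + \<gamma>)"
  proof -
    have "(\<Gamma> / \<gamma> - 1) / (\<Gamma> / \<gamma> + 1) = ((\<Gamma> - \<gamma>) / \<gamma>) / ((\<Gamma> + \<gamma>) / \<gamma>)"
      using \<open>0 < \<gamma>\<close> by (simp add: diff_divide_distrib add_divide_distrib)
    then show ?thesis
      using \<open>0 < \<gamma>\<close> by (simp add: assms(20,21))
  qed
  \<comment> \<open>\<open>\<gamma> < \<Gamma>\<close> makes \<open>q\<close> positive, so that
    \<open>1 / q\<close> and \<open>ln q\<close> are genuine.\<close>
  then have q01: "0 < q" "q < 1"
    using \<open>0 < \<gamma>\<close> \<open>\<gamma> < \<Gamma>\<close> by auto
  have bound: "best_error K Ht Hc HH tp r u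
      \<le> hnorm HH u / q * (1 / real r) powr \<bar>ln q / ln (real R)\<bar>"
    if "2 \<le> R" "rA + 1 \<le> R" "1 \<le> r" for R r
  proof (rule geometric_to_algebraic_decay[OF q01 that(1,3) Z.hnorm_nonneg[OF \<open>u \<in> carrier HH\<close>]])
    fix k assume "R ^ k \<le> r"
    obtain n v where v: "tensor_sum n v" "n < (rA + 1) ^ k" "hdist HH u v \<le> q ^ k * hnorm HH u"
      using richardson_approximation[OF assms(7-11) rank_A \<open>u \<in> carrier HH\<close> rank_b \<open>rb \<le> rA\<close>]
      unfolding q by blast
    have "(rA + 1) ^ k \<le> R ^ k" using that(2) by (intro power_mono) auto
    then have "n \<le> r" using v(2) \<open>R ^ k \<le> r\<close> by linarith
    then show "best_error K Ht Hc HH tp r u \<le> q ^ k * hnorm HH u"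
      using best_error_le[OF \<open>u \<in> carrier HH\<close> v(1)] v(3) by force
  qed
  show ?thesis
    \<comment> \<open>\<open>R = rA + 2\<close> always meets \<open>2 \<le> R\<close>; for
      \<open>R = rA + 1\<close> this follows from \<open>1 \<le> rA\<close>, as the index of the
      identity factor lies in \<open>{1..rA}\<close>.\<close>
    using bound[of "rA + 2"] bound[of "rA + 1"] by auto
qed

end
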